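(* Let $(X,Y)$ be a bivariate normal random vector with mean vector $(\mu_X,\mu_Y)\in\mathbb{R}^2$, variances $\sigma_X^2,\sigma_Y^2$ with $\sigma_X,\sigma_Y>0$, and correlation coefficient $\rho\in(-1,1)$. Let $p_Z$ be the density of the product $Z=XY$. Then $p_Z$ is log-convex on $(0,\infty)$ if and only if $$\frac{\mu_X}{\sigma_X}+\frac{\mu_Y}{\sigma_Y}=0,$$ and $p_Z$ is log-convex on $(-\infty,0)$ if and only if $$\frac{\mu_X}{\sigma_X}-\frac{\mu_Y}{\sigma_Y}=0.$$ Consequently, $p_Z$ is log-convex on both open half-lines $(-\infty,0)$ and $(0,\infty)$ if and only if $\mu_X=\mu_Y=0$.
   Context: A positive function $h:I\to(0,\infty)$ on an interval $I\subseteq\mathbb{R}$ is log-convex on $I$ if $h(tx+(1-t)y)\le h(x)^t h(y)^{1-t}$ for all $x,y\in I$, $t\in[0,1]$. The density $p_Z$ is taken to be the version (with respect to Lebesgue measure) that is continuous on $\mathbb{R}\setminus\{0\}$. *)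

theory Defs
  imports "HOL-Probability.Probability"
begin

definition bivariate_normal_density ::
  "real \<Rightarrow> real \<Rightarrow> real \<Rightarrow> real \<Rightarrow> real \<Rightarrow> real \<times> real \<Rightarrow> real" where
  "bivariate_normal_density \<mu>X \<mu>Y \<sigma>X \<sigma>Y \<rho> = (\<lambda>(x, y).
     1 / (2 * pi * \<sigma>X * \<sigma>Y * sqrt (1 - \<rho>\<^sup>2)) *
     exp (- (((x - \<mu>X) / \<sigma>X)\<^sup>2
             - 2 * \<rho> * ((x - \<mu>X) / \<sigma>X) * ((y - \<mu>Y) / \<sigma>Y)
             + ((y - \<mu>Y) / \<sigma>Y)\<^sup>2) / (2 * (1 - \<rho>\<^sup>2))))"

definition log_convex_on :: "real set \<Rightarrow> (real \<Rightarrow> real) \<Rightarrow> bool" where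
  "log_convex_on I h \<longleftrightarrow>
     (\<forall>x\<in>I. 0 < h x) \<and>
     (\<forall>x\<in>I. \<forall>y\<in>I. \<forall>t\<in>{0..1}.
        h (t * x + (1 - t) * y) \<le> h x powr t * h y powr (1 - t))"

end

theory Submission
  imports Defs "HOL-Real_Asymp.Real_Asymp"
begin

text \<open>
  Let \<open>w = z / (\<sigma>X * \<sigma>Y)\<close> with \<open>z > 0\<close>, and parametrise the branches of the hyperbola \<open>x * y = z\<close> by
  \<open>x = \<plusminus> \<sigma>X * (S + s)\<close>, \<open>y = \<plusminus> \<sigma>Y * (S - s)\<close> with \<open>S = sqrt (w + s\<^sup>2)\<close>, so that \<open>dx / x = ds / S\<close>.
  The density of the product then becomes an exponential in \<open>z\<close> times
  \<open>\<integral> G s * cosh (k * S) / S ds\<close>, where \<open>G\<close> is a Gaussian weight independent of \<open>z\<close> and \<open>k\<close> is a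
  positive multiple of \<open>\<mu>X / \<sigma>X + \<mu>Y / \<sigma>Y\<close>. If \<open>k = 0\<close>, this is a mixture of the log-convex functions
  \<open>1 / sqrt (w + s\<^sup>2)\<close>. If \<open>k \<noteq> 0\<close>, the integral tends to infinity but grows at most like
  \<open>exp (\<bar>k\<bar> * sqrt w)\<close>, which is impossible for a log-convex function. The negative half-line reduces to
  the positive one by replacing \<open>Y\<close> with \<open>- Y\<close>, that is \<open>\<mu>Y\<close> with \<open>- \<mu>Y\<close> and \<open>\<rho>\<close> with \<open>- \<rho>\<close>.
\<close>

subsection \<open>Log-convex functions\<close>

lemma log_convex_onI:
  assumes "\<And>x. x \<in> I \<Longrightarrow> 0 < h x"
    and "\<And>x y t. x \<in> I \<Longrightarrow> y \<in> I \<Longrightarrow> 0 \<le> t \<Longrightarrow> t \<le> 1 \<Longrightarrow>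
      h (t * x + (1 - t) * y) \<le> h x powr t * h y powr (1 - t)"
  shows "log_convex_on I h"
  using assms by (auto simp: log_convex_on_def)

lemma log_convex_onD:
  assumes "log_convex_on I h" "x \<in> I" "y \<in> I" "0 \<le> t" "t \<le> 1"
  shows "h (t * x + (1 - t) * y) \<le> h x powr t * h y powr (1 - t)"
  using assms by (auto simp: log_convex_on_def)

lemma log_convex_on_pos: "log_convex_on I h \<Longrightarrow> x \<in> I \<Longrightarrow> 0 < h x"
  by (auto simp: log_convex_on_def)

text \<open>Convexity of \<open>I\<close> keeps the intermediate points
  \<open>t * x + (1 - t) * y\<close> in \<open>I\<close>, where \<open>f\<close> and
  \<open>g\<close> agree.\<close>

lemma log_convex_on_cong:
  assumes "convex I" "\<And>x. x \<in> I \<Longrightarrow> f x = g x"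
  shows "log_convex_on I f \<longleftrightarrow> log_convex_on I g"
proof -
  have "t * x + (1 - t) * y \<in> I" if "x \<in> I" "y \<in> I" "t \<in> {0..1}" for x y t
    using convexD_alt[OF assms(1) that(2,1), of t] that by (simp add: add.commute)
  then show ?thesis
    using assms(2) unfolding log_convex_on_def by auto
qed

lemma log_convex_on_reflect:
  "log_convex_on {..<0} h \<longleftrightarrow> log_convex_on {0<..} (\<lambda>x. h (- x))"
proof
  assume L: "log_convex_on {..<0} h"
  show "log_convex_on {0<..} (\<lambda>x. h (- x))"
  proof (rule log_convex_onI)
    fix x y t :: real assume "x \<in> {0<..}" "y \<in> {0<..}" "0 \<le> t" "t \<le> 1"
    then show "h (- (t * x + (1 - t) * y)) \<le> h (- x) powr t * h (- y) powr (1 - t)"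
      using log_convex_onD[OF L, of "- x" "- y" t] by (simp add: algebra_simps)
  qed (use log_convex_on_pos[OF L] in auto)
next
  assume L: "log_convex_on {0<..} (\<lambda>x. h (- x))"
  show "log_convex_on {..<0} h"
  proof (rule log_convex_onI)
    fix x y t :: real assume "x \<in> {..<0}" "y \<in> {..<0}" "0 \<le> t" "t \<le> 1"
    then show "h (t * x + (1 - t) * y) \<le> h x powr t * h y powr (1 - t)"
      using log_convex_onD[OF L, of "- x" "- y" t] by (simp add: algebra_simps)
  next
    fix x :: real assume "x \<in> {..<0}"
    then show "0 < h x" using log_convex_on_pos[OF L, of "- x"] by simp
  qed
qed

lemma log_convex_on_mult:
  assumes "convex I" and f: "log_convex_on I f" and g: "log_convex_on I g"
  shows "log_convex_on I (\<lambda>x. f x * g x)"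
proof (rule log_convex_onI)
  fix x assume "x \<in> I"
  then show "0 < f x * g x" using log_convex_on_pos[OF f] log_convex_on_pos[OF g] by simp
next
  fix x y t :: real assume I: "x \<in> I" "y \<in> I" and t: "0 \<le> t" "t \<le> 1"
  let ?z = "t * x + (1 - t) * y"
  \<comment> \<open>Multiplying the two inequalities requires \<open>0 \<le> g ?z\<close>, so the
    intermediate point must lie in \<open>I\<close>.\<close>
  have "?z \<in> I"
    using convexD_alt[OF assms(1) I(2,1), of t] t by (simp add: add.commute)
  then have pos: "0 < f x" "0 < f y" "0 < g x" "0 < g y" "0 < g ?z"
    using I log_convex_on_pos[OF f] log_convex_on_pos[OF g] by auto
  have "f ?z * g ?z \<le> (f x powr t * f y powr (1 - t)) * (g x powr t * g y powr (1 - t))"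
    using pos by (intro mult_mono log_convex_onD[OF f I t] log_convex_onD[OF g I t]) auto
  then show "f ?z * g ?z \<le> (f x * g x) powr t * (f y * g y) powr (1 - t)"
    using pos by (simp add: powr_mult mult_ac)
qed

text \<open>The logarithm is affine, so equality holds. Such factors can be multiplied in, or
  cancelled with \<open>- b\<close>, without affecting log-convexity.\<close>

lemma log_convex_on_exp_affine:
  assumes "0 < c"
  shows "log_convex_on I (\<lambda>z. c * exp (b * z))"
proof (rule log_convex_onI)
  fix x y t :: real
  have "(c * exp (b * x)) powr t * (c * exp (b * y)) powr (1 - t)
      = exp (t * (ln c + b * x) + (1 - t) * (ln c + b * y))"
    using assms by (simp add: powr_def ln_mult exp_add[symmetric])
  also have "\<dots> = exp (ln c + b * (t * x + (1 - t) * y))"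
    by (simp add: algebra_simps)
  also have "\<dots> = c * exp (b * (t * x + (1 - t) * y))"
    using assms by (simp add: exp_add)
  finally show "c * exp (b * (t * x + (1 - t) * y))
      \<le> (c * exp (b * x)) powr t * (c * exp (b * y)) powr (1 - t)" by simp
qed (use assms in simp)

text \<open>The logarithm is minus one half of the concave function \<open>ln (z / r + q)\<close>.
  Concavity enters as the weighted inequality between geometric and arithmetic mean. These are the
  kernels of the mixture in the case \<open>k = 0\<close>, with
  \<open>q = s\<^sup>2\<close>.\<close>

lemma log_convex_on_inverse_sqrt:
  assumes "0 < r" "0 \<le> q"
  shows "log_convex_on {0<..} (\<lambda>z. 1 / sqrt (z / r + q))"
proof (rule log_convex_onI)
  fix z :: real assume "z \<in> {0<..}"
  then show "0 < 1 / sqrt (z / r + q)" using assms by (simp add: add_pos_nonneg)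
next
  fix x y t :: real assume xy: "x \<in> {0<..}" "y \<in> {0<..}" and t: "0 \<le> t" "t \<le> 1"
  define u v where "u = x / r + q" and "v = y / r + q"
  have uv: "0 < u" "0 < v" using xy assms by (auto simp: u_def v_def add_pos_nonneg)
  have e: "(t * x + (1 - t) * y) / r + q = t * u + (1 - t) * v"
    using assms by (simp add: u_def v_def field_simps)
  have young: "u powr t * v powr (1 - t) \<le> t * u + (1 - t) * v"
    using Youngs_inequality_0[of t "1 - t" u v] uv t by simp
  have "sqrt u powr t * sqrt v powr (1 - t) = sqrt (u powr t * v powr (1 - t))"
    using uv by (simp add: powr_half_sqrt[symmetric] powr_powr powr_mult mult.commute)
  also have "\<dots> \<le> sqrt (t * u + (1 - t) * v)"
    using young by simp
  finally have "1 / sqrt (t * u + (1 - t) * v) \<le> 1 / (sqrt u powr t * sqrt v powr (1 - t))"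
    using uv by (intro divide_left_mono mult_pos_pos) (auto intro: less_le_trans[OF _ young])
  then show "1 / sqrt ((t * x + (1 - t) * y) / r + q)
      \<le> (1 / sqrt (x / r + q)) powr t * (1 / sqrt (y / r + q)) powr (1 - t)"
    using uv unfolding e u_def[symmetric] v_def[symmetric]
    by (simp add: powr_divide)
qed

section \<open>Integrals and growth of log-convex functions\<close>

lemma integral_pos_everywhere:
  fixes f :: "real \<Rightarrow> real"
  assumes "integrable lborel f" "\<And>x. 0 < f x"
  shows "0 < integral\<^sup>L lborel f"
proof -
  have "integral\<^sup>L lborel f \<noteq> 0"
  proof
    assume "integral\<^sup>L lborel f = 0"
    then have "AE x in lborel. f x = 0"
      using assms integral_nonneg_eq_0_iff_AE[OF assms(1)] by (simp add: less_imp_le)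
    then have "AE x in lborel. x \<notin> (UNIV :: real set)"
      by (rule eventually_mono) (metis assms(2) less_irrefl)
    then have "emeasure lborel (UNIV :: real set) = 0"
      by (subst (asm) AE_iff_measurable[where N = UNIV]) auto
    then show False by simp
  qed
  moreover have "0 \<le> integral\<^sup>L lborel f"
    by (rule integral_nonneg_AE) (use assms in \<open>simp add: less_imp_le\<close>)
  ultimately show ?thesis by simp
qed

text \<open>Hoelder's inequality, reduced to Young's inequality by normalising with the two integrals.\<close>

lemma log_convex_on_integral:
  fixes k :: "real \<Rightarrow> real \<Rightarrow> real"
  assumes "convex I"
    and int: "\<And>z. z \<in> I \<Longrightarrow> integrable lborel (\<lambda>s. k s z)"
    and lc: "\<And>s. log_convex_on I (k s)"
  shows "log_convex_on I (\<lambda>z. LBINT s. k s z)"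
proof (rule log_convex_onI)
  fix z assume "z \<in> I"
  then show "0 < (LBINT s. k s z)"
    by (intro integral_pos_everywhere int log_convex_on_pos[OF lc])
next
  fix x y t :: real assume I: "x \<in> I" "y \<in> I" and t: "0 \<le> t" "t \<le> 1"
  define U V where "U = (LBINT s. k s x)" and "V = (LBINT s. k s y)"
  have UV: "0 < U" "0 < V"
    unfolding U_def V_def using I by (auto intro!: integral_pos_everywhere int log_convex_on_pos[OF lc])
  define P where "P = U powr t * V powr (1 - t)"
  have P: "0 < P" using UV by (simp add: P_def)
  have zI: "t * x + (1 - t) * y \<in> I"
    using convexD_alt[OF assms(1) I(2,1), of t] t by (simp add: add.commute)
  have ptw: "k s (t * x + (1 - t) * y) \<le> P * (t * (k s x / U) + (1 - t) * (k s y / V))" for s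
  proof -
    have kp: "0 < k s x" "0 < k s y" using log_convex_on_pos[OF lc] I by auto
    have "k s (t * x + (1 - t) * y) \<le> k s x powr t * k s y powr (1 - t)"
      using log_convex_onD[OF lc I t] .
    also have "\<dots> = P * ((k s x / U) powr t * (k s y / V) powr (1 - t))"
      using kp UV by (simp add: P_def powr_divide)
    also have "\<dots> \<le> P * (t * (k s x / U) + (1 - t) * (k s y / V))"
      using kp UV t P by (intro mult_left_mono Youngs_inequality_0) auto
    finally show ?thesis .
  qed
  have "(LBINT s. k s (t * x + (1 - t) * y))
      \<le> (LBINT s. P * (t * (k s x / U) + (1 - t) * (k s y / V)))"
    by (intro integral_mono ptw int zI) (use int I in auto)
  also have "\<dots> = P * (t * (U / U) + (1 - t) * (V / V))"
    using int I by (simp add: U_def V_def)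
  also have "\<dots> = P" using UV by simp
  finally show "(LBINT s. k s (t * x + (1 - t) * y))
      \<le> (LBINT s. k s x) powr t * (LBINT s. k s y) powr (1 - t)"
    by (simp add: P_def U_def V_def)
qed

text \<open>Once a log-convex function exceeds its value at an earlier point, it grows at least exponentially.\<close>

lemma not_log_convex_on_subexponential:
  assumes "filterlim \<Phi> at_top at_top"
    and "0 < C" "0 \<le> (k::real)" "eventually (\<lambda>z. \<Phi> z \<le> C * exp (k * sqrt z)) at_top"
  shows "\<not> log_convex_on {0<..} \<Phi>"
proof
  assume L: "log_convex_on {0<..} \<Phi>"
  have "eventually (\<lambda>x. \<Phi> 1 < \<Phi> x) at_top"
    using assms(1) by (simp add: filterlim_at_top_dense)
  then have "eventually (\<lambda>x. \<Phi> 1 < \<Phi> x \<and> 1 < x) at_top"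
    using eventually_gt_at_top[of "1::real"] by eventually_elim simp
  then obtain x where x: "\<Phi> 1 < \<Phi> x" "1 < x"
    using eventually_happens'[OF trivial_limit_at_top_linorder] by blast
  define \<delta> where "\<delta> = ln (\<Phi> x) - ln (\<Phi> 1)"
  have p1: "0 < \<Phi> 1" using log_convex_on_pos[OF L] by simp
  have \<delta>: "0 < \<delta>" using x p1 by (simp add: \<delta>_def)
  \<comment> \<open>This compares chord slopes of \<open>ln (\<Phi> z)\<close>: the slope from 1 to
    \<open>x\<close> is at most the slope from 1 to \<open>y\<close>, and the latter is controlled
    by the growth bound at \<open>y\<close>.\<close>
  have bd: "\<delta> \<le> (x - 1) / (y - 1) * (ln C + k * sqrt y - ln (\<Phi> 1))"
    if y: "x < y" "\<Phi> y \<le> C * exp (k * sqrt y)" for y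
  proof -
    \<comment> \<open>The weight that makes \<open>x\<close> the convex combination of 1 and
      \<open>y\<close>.\<close>
    define t where "t = (y - x) / (y - 1)"
    have t: "0 \<le> t" "t \<le> 1" "1 - t = (x - 1) / (y - 1)"
      using x y by (auto simp: t_def field_simps)
    have "t * 1 + (1 - t) * y = 1 + (1 - t) * (y - 1)" by (simp add: algebra_simps)
    also have "\<dots> = x" using x y by (simp add: t(3))
    finally have tx: "t * 1 + (1 - t) * y = x" .
    have py: "0 < \<Phi> y" using log_convex_on_pos[OF L] x y by simp
    have "\<Phi> x \<le> \<Phi> 1 powr t * \<Phi> y powr (1 - t)"
      using log_convex_onD[OF L, of 1 y t] x y t(1,2) tx by simp
    then have "ln (\<Phi> x) \<le> ln (\<Phi> 1 powr t * \<Phi> y powr (1 - t))"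
      using x p1 py by (subst ln_le_cancel_iff) auto
    also have "\<dots> = t * ln (\<Phi> 1) + (1 - t) * ln (\<Phi> y)"
      using p1 py by (simp add: ln_mult ln_powr)
    finally have "\<delta> \<le> (1 - t) * (ln (\<Phi> y) - ln (\<Phi> 1))"
      by (simp add: \<delta>_def algebra_simps)
    also have "ln (\<Phi> y) \<le> ln (C * exp (k * sqrt y))"
      using py y assms(2) by (subst ln_le_cancel_iff) auto
    then have "(1 - t) * (ln (\<Phi> y) - ln (\<Phi> 1)) \<le> (1 - t) * (ln C + k * sqrt y - ln (\<Phi> 1))"
      using t assms(2) by (intro mult_left_mono) (auto simp: ln_mult)
    finally show ?thesis by (simp add: t(3))
  qed
  \<comment> \<open>As \<open>y\<close> grows, \<open>sqrt y / y\<close> tends to 0, so the fixed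
    positive gain \<open>\<delta>\<close> is bounded by quantities tending to 0.\<close>
  have "((\<lambda>y. (x - 1) / (y - 1) * (ln C + k * sqrt y - ln (\<Phi> 1))) \<longlongrightarrow> 0) at_top"
    by real_asymp
  then have "\<delta> \<le> 0"
  proof (rule tendsto_lowerbound)
    show "eventually (\<lambda>y. \<delta> \<le> (x - 1) / (y - 1) * (ln C + k * sqrt y - ln (\<Phi> 1))) at_top"
      using eventually_gt_at_top[of x] assms(4) by eventually_elim (rule bd)
  qed simp
  with \<delta> show False by simp
qed

subsection \<open>Cosh mixtures\<close>

text \<open>All exponential moments are required because
  \<open>cosh (k * sqrt (w + s\<^sup>2))\<close> grows like
  \<open>exp (\<bar>k\<bar> * \<bar>s\<bar>)\<close> in \<open>s\<close>. The Gaussian weight of the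
  product density is the intended instance.\<close>

locale exp_integrable_weight =
  fixes G :: "real \<Rightarrow> real"
  assumes measurable_weight [measurable]: "G \<in> borel_measurable borel"
    and weight_pos: "\<And>s. 0 < G s"
    and exp_integrable: "\<And>K. integrable lborel (\<lambda>s. G s * exp (K * \<bar>s\<bar>))"
begin

text \<open>The two branches of the hyperbola contribute \<open>exp (k * S)\<close> and
  \<open>exp (- k * S)\<close> with \<open>S = sqrt (w + s\<^sup>2)\<close>, which add up to the
  \<open>cosh\<close>; the factor \<open>1 / S\<close> comes from \<open>dx / x = ds / S\<close>.
  For \<open>w > 0\<close> the integrand is integrable, so the value is a genuine integral
  there.\<close>

definition mixture :: "real \<Rightarrow> real \<Rightarrow> real" where
  "mixture k w = (LBINT s. G s * (cosh (k * sqrt (w + s\<^sup>2)) / sqrt (w + s\<^sup>2)))"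

text \<open>The estimate \<open>sqrt (w + s\<^sup>2) \<le> sqrt w + \<bar>s\<bar>\<close> separates
  \<open>w\<close> from \<open>s\<close>. The bound is uniform for \<open>w\<close> between
  \<open>a\<close> and \<open>b\<close>, so it serves for integrability, for dominated convergence
  and for the growth estimate.\<close>

lemma kernel_bound:
  assumes "0 < a" "a \<le> w" "w \<le> b"
  shows "\<bar>G s * (cosh (k * sqrt (w + s\<^sup>2)) / sqrt (w + s\<^sup>2))\<bar>
    \<le> exp (\<bar>k\<bar> * sqrt b) / sqrt a * (G s * exp (\<bar>k\<bar> * \<bar>s\<bar>))"
proof -
  have S: "sqrt (w + s\<^sup>2) \<le> sqrt b + \<bar>s\<bar>"
    using sqrt_add_le_add_sqrt[of w "s\<^sup>2"] assms by (smt (verit) real_sqrt_abs real_sqrt_le_mono zero_le_power2)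
  have "cosh (k * sqrt (w + s\<^sup>2)) = cosh (\<bar>k\<bar> * sqrt (w + s\<^sup>2))"
    by (metis abs_mult abs_of_nonneg cosh_real_abs real_sqrt_ge_zero add_nonneg_nonneg assms(1,2) less_imp_le order_trans zero_le_power2)
  also have "\<dots> \<le> exp (\<bar>k\<bar> * sqrt (w + s\<^sup>2))"
    using assms by (simp add: cosh_def add_nonneg_nonneg)
  also have "\<dots> \<le> exp (\<bar>k\<bar> * (sqrt b + \<bar>s\<bar>))"
    using S by (simp add: mult_left_mono)
  also have "\<dots> = exp (\<bar>k\<bar> * sqrt b) * exp (\<bar>k\<bar> * \<bar>s\<bar>)"
    by (simp add: exp_add[symmetric] algebra_simps)
  finally have c: "cosh (k * sqrt (w + s\<^sup>2)) \<le> exp (\<bar>k\<bar> * sqrt b) * exp (\<bar>k\<bar> * \<bar>s\<bar>)" .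
  have "sqrt a \<le> sqrt (w + s\<^sup>2)" using assms by (simp add: add_increasing2)
  then have "cosh (k * sqrt (w + s\<^sup>2)) / sqrt (w + s\<^sup>2)
      \<le> exp (\<bar>k\<bar> * sqrt b) * exp (\<bar>k\<bar> * \<bar>s\<bar>) / sqrt a"
    using c assms by (intro frac_le) auto
  then have "G s * (cosh (k * sqrt (w + s\<^sup>2)) / sqrt (w + s\<^sup>2))
      \<le> G s * (exp (\<bar>k\<bar> * sqrt b) * exp (\<bar>k\<bar> * \<bar>s\<bar>) / sqrt a)"
    using weight_pos[of s] by (intro mult_left_mono) auto
  moreover have "0 \<le> G s * (cosh (k * sqrt (w + s\<^sup>2)) / sqrt (w + s\<^sup>2))"
    using weight_pos[of s] assms by (auto intro!: mult_nonneg_nonneg divide_nonneg_nonneg)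
  ultimately show ?thesis by (simp add: mult_ac)
qed

lemma integrable_kernel:
  assumes "0 < w"
  shows "integrable lborel (\<lambda>s. G s * (cosh (k * sqrt (w + s\<^sup>2)) / sqrt (w + s\<^sup>2)))"
proof (rule Bochner_Integration.integrable_bound)
  show "integrable lborel (\<lambda>s. exp (\<bar>k\<bar> * sqrt w) / sqrt w * (G s * exp (\<bar>k\<bar> * \<bar>s\<bar>)))"
    by (intro integrable_mult_right exp_integrable)
  show "(\<lambda>s. G s * (cosh (k * sqrt (w + s\<^sup>2)) / sqrt (w + s\<^sup>2))) \<in> borel_measurable lborel"
    by (simp add: cosh_def)
  show "AE s in lborel. norm (G s * (cosh (k * sqrt (w + s\<^sup>2)) / sqrt (w + s\<^sup>2)))
      \<le> norm (exp (\<bar>k\<bar> * sqrt w) / sqrt w * (G s * exp (\<bar>k\<bar> * \<bar>s\<bar>)))"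
    unfolding real_norm_def
    by (intro AE_I2 order_trans[OF kernel_bound[OF assms order_refl order_refl] abs_ge_self])
qed

text \<open>Dominated convergence along sequences. The dominating function degenerates as
  \<open>a\<close> tends to 0, so the argument runs on intervals bounded away from 0 and is then
  localised at each point \<open>w\<close> by the interval from \<open>w / 2\<close> to
  \<open>2 * w\<close>.\<close>

lemma continuous_on_mixture: "continuous_on {0<..} (mixture k)"
proof -
  have "continuous_on {a<..<b} (mixture k)" if "0 < a" for a b
    unfolding continuous_on_sequentially
  proof (intro allI ballI impI)
    fix X w assume w: "w \<in> {a<..<b}" and "(\<forall>n. X n \<in> {a<..<b}) \<and> X \<longlonglongrightarrow> w"
    then have X: "\<And>n. X n \<in> {a<..<b}" "X \<longlonglongrightarrow> w" by auto
    show "(mixture k \<circ> X) \<longlonglongrightarrow> mixture k w"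
      unfolding comp_def mixture_def
    proof (rule integral_dominated_convergence)
      show "integrable lborel (\<lambda>s. exp (\<bar>k\<bar> * sqrt b) / sqrt a * (G s * exp (\<bar>k\<bar> * \<bar>s\<bar>)))"
        by (intro integrable_mult_right exp_integrable)
      show "AE s in lborel. norm (G s * (cosh (k * sqrt (X n + s\<^sup>2)) / sqrt (X n + s\<^sup>2)))
          \<le> exp (\<bar>k\<bar> * sqrt b) / sqrt a * (G s * exp (\<bar>k\<bar> * \<bar>s\<bar>))" for n
        using kernel_bound[OF that, of "X n" b] X(1)[of n] by (simp add: less_imp_le)
      show "AE s in lborel. (\<lambda>n. G s * (cosh (k * sqrt (X n + s\<^sup>2)) / sqrt (X n + s\<^sup>2)))
          \<longlonglongrightarrow> G s * (cosh (k * sqrt (w + s\<^sup>2)) / sqrt (w + s\<^sup>2))"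
      proof (rule AE_I2)
        fix s
        have "w + s\<^sup>2 \<noteq> 0" using w that by (smt (verit) greaterThanLessThan_iff zero_le_power2)
        then show "(\<lambda>n. G s * (cosh (k * sqrt (X n + s\<^sup>2)) / sqrt (X n + s\<^sup>2)))
          \<longlonglongrightarrow> G s * (cosh (k * sqrt (w + s\<^sup>2)) / sqrt (w + s\<^sup>2))"
          by (auto intro!: tendsto_intros X(2))
      qed
    qed (auto simp: cosh_def)
  qed
  then have "isCont (mixture k) w" if "0 < w" for w
    using that continuous_on_eq_continuous_at[of "{w/2<..<2*w}"] by force
  then show ?thesis by (simp add: continuous_at_imp_continuous_on)
qed

lemma mixture_le:
  assumes "1 \<le> w"
  shows "mixture k w \<le> (LBINT s. G s * exp (\<bar>k\<bar> * \<bar>s\<bar>)) * exp (\<bar>k\<bar> * sqrt w)"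
proof -
  \<comment> \<open>The kernel bound with \<open>a = 1\<close> and \<open>b = w\<close>, which
    explains \<open>sqrt 1\<close>.\<close>
  have "mixture k w \<le> (LBINT s. exp (\<bar>k\<bar> * sqrt w) / sqrt 1 * (G s * exp (\<bar>k\<bar> * \<bar>s\<bar>)))"
    unfolding mixture_def
    by (intro integral_mono integrable_kernel integrable_mult_right exp_integrable
        order_trans[OF abs_ge_self kernel_bound]) (use assms in auto)
  then show ?thesis by (simp add: mult.commute)
qed

text \<open>Only the part \<open>0 \<le> s \<le> 1\<close> of the integral is kept. There
  \<open>sqrt (w + s\<^sup>2)\<close> lies between \<open>sqrt w\<close> and
  \<open>sqrt (w + 1)\<close>, so the kernel is at least
  \<open>exp (\<bar>k\<bar> * sqrt w) / 2 / sqrt (w + 1)\<close>, which tends to infinity.\<close>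

lemma mixture_at_top:
  assumes "k \<noteq> 0"
  shows "filterlim (mixture k) at_top at_top"
proof -
  define g where "g = (LBINT s. G s * indicator {0..1} s)"
  have iG: "integrable lborel G" using exp_integrable[of 0] by simp
  have iGI: "integrable lborel (\<lambda>s. G s * indicator {0..1} s)"
    using integrable_mult_indicator[of "{0..1}" lborel G] iG by (simp add: mult.commute)
  have "0 \<le> g"
    unfolding g_def by (intro integral_nonneg_AE AE_I2) (use weight_pos in \<open>simp add: less_imp_le\<close>)
  moreover have "g \<noteq> 0"
  proof
    assume "g = 0"
    then have "AE s in lborel. G s * indicator {0..1} s = 0"
      unfolding g_def
      by (subst (asm) integral_nonneg_eq_0_iff_AE[OF iGI]) (use weight_pos in \<open>auto simp: less_imp_le\<close>)
    then have "AE s in lborel. s \<notin> {0..1::real}"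
      by eventually_elim (use weight_pos in \<open>auto simp: indicator_def split: if_splits, metis less_irrefl\<close>)
    then have "emeasure lborel {0..1::real} = 0"
      by (subst (asm) AE_iff_measurable[where N = "{0..1}"]) auto
    then show False by simp
  qed
  ultimately have g: "0 < g" by simp
  have lower: "g * (exp (\<bar>k\<bar> * sqrt w) / 2 / sqrt (w + 1)) \<le> mixture k w" if w: "0 < w" for w
  proof -
    have "(LBINT s. exp (\<bar>k\<bar> * sqrt w) / 2 / sqrt (w + 1) * (G s * indicator {0..1} s)) \<le> mixture k w"
      unfolding mixture_def
    proof (intro integral_mono integrable_kernel w integrable_mult_right iGI)
      fix s :: real
      let ?S = "sqrt (w + s\<^sup>2)"
      have S0: "0 < ?S" using w by (simp add: add_pos_nonneg)
      show "exp (\<bar>k\<bar> * sqrt w) / 2 / sqrt (w + 1) * (G s * indicator {0..1} s) \<le> G s * (cosh (k * ?S) / ?S)"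
      proof (cases "s \<in> {0..1}")
        case True
        then have S: "?S \<le> sqrt (w + 1)" by (auto simp: power_le_one)
        have "exp (\<bar>k\<bar> * sqrt w) \<le> exp (\<bar>k\<bar> * ?S)" by (simp add: mult_left_mono)
        also have "\<dots> \<le> 2 * cosh (\<bar>k\<bar> * ?S)" by (simp add: cosh_def)
        also have "cosh (\<bar>k\<bar> * ?S) = cosh (k * ?S)"
          using S0 by (metis abs_mult abs_of_pos cosh_real_abs)
        finally have "exp (\<bar>k\<bar> * sqrt w) / 2 / sqrt (w + 1) \<le> cosh (k * ?S) / ?S"
          using S S0 by (intro frac_le) auto
        then have "G s * (exp (\<bar>k\<bar> * sqrt w) / 2 / sqrt (w + 1)) \<le> G s * (cosh (k * ?S) / ?S)"
          using weight_pos[of s] by (intro mult_left_mono) auto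
        then show ?thesis using True by (simp add: mult.commute)
      next
        case False
        then show ?thesis using weight_pos[of s] S0 by simp
      qed
    qed
    then show ?thesis by (simp add: g_def mult.commute)
  qed
  have k: "0 < \<bar>k\<bar>" using assms by simp
  have "filterlim (\<lambda>w. g * (exp (\<bar>k\<bar> * sqrt w) / 2 / sqrt (w + 1))) at_top at_top"
    using g k by real_asymp
  then show ?thesis
    by (rule filterlim_at_top_mono) (rule eventually_mono[OF eventually_gt_at_top[of 0] lower])
qed

lemma log_convex_on_mixture_iff:
  assumes "0 < c" "0 < r"
  shows "log_convex_on {0<..} (\<lambda>z. c * exp (b * z) * mixture k (z / r)) \<longleftrightarrow> k = 0"
proof
  assume "k = 0"
  \<comment> \<open>Writing the constant weight as \<open>G s * exp (0 * z)\<close> makes it an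
    instance of the exponential-affine lemma.\<close>
  have lc: "log_convex_on {0<..} (\<lambda>z. G s * exp (0 * z) * (1 / sqrt (z / r + s\<^sup>2)))" for s
    by (intro log_convex_on_mult convex_real_interval log_convex_on_exp_affine log_convex_on_inverse_sqrt)
      (use weight_pos assms in auto)
  have "log_convex_on {0<..} (\<lambda>z. LBINT s. G s * exp (0 * z) * (1 / sqrt (z / r + s\<^sup>2)))"
    by (intro log_convex_on_integral convex_real_interval lc) (use integrable_kernel[where k=0] assms in auto)
  then have "log_convex_on {0<..} (\<lambda>z. mixture k (z / r))"
    by (simp add: mixture_def \<open>k = 0\<close>)
  then show "log_convex_on {0<..} (\<lambda>z. c * exp (b * z) * mixture k (z / r))"
    by (intro log_convex_on_mult convex_real_interval log_convex_on_exp_affine assms)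
next
  assume L: "log_convex_on {0<..} (\<lambda>z. c * exp (b * z) * mixture k (z / r))"
  \<comment> \<open>Multiplication by the log-affine factor \<open>exp (- b * z)\<close> preserves
    log-convexity and leaves only the mixture, whose growth is subexponential.\<close>
  have "log_convex_on {0<..} (\<lambda>z. 1 * exp (- b * z) * (c * exp (b * z) * mixture k (z / r)))"
    by (intro log_convex_on_mult[OF convex_real_interval(3) log_convex_on_exp_affine L]) simp
  also have "(\<lambda>z. 1 * exp (- b * z) * (c * exp (b * z) * mixture k (z / r))) = (\<lambda>z. c * mixture k (z / r))"
    by (simp add: exp_minus field_simps)
  finally have L': "log_convex_on {0<..} (\<lambda>z. c * mixture k (z / r))" .
  show "k = 0"
  proof (rule ccontr)
    assume k: "k \<noteq> 0"
    define C where "C = c * (LBINT s. G s * exp (\<bar>k\<bar> * \<bar>s\<bar>))"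
    have "0 < C" unfolding C_def
      using assms weight_pos by (intro mult_pos_pos integral_pos_everywhere exp_integrable) auto
    have "filterlim (\<lambda>z. z / r) at_top at_top" using assms by real_asymp
    then have "filterlim (\<lambda>z. mixture k (z / r)) at_top at_top"
      by (rule filterlim_compose[OF mixture_at_top[OF k]])
    then have lim: "filterlim (\<lambda>z. c * mixture k (z / r)) at_top at_top"
      by (rule filterlim_tendsto_pos_mult_at_top[OF tendsto_const assms(1)])
    \<comment> \<open>For \<open>z \<ge> r\<close> the argument \<open>z / r\<close> is at least 1,
      and \<open>sqrt (z / r) = sqrt z / sqrt r\<close> gives the rate
      \<open>\<bar>k\<bar> / sqrt r\<close>.\<close>
    have "eventually (\<lambda>z. c * mixture k (z / r) \<le> C * exp (\<bar>k\<bar> / sqrt r * sqrt z)) at_top"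
      using eventually_ge_at_top[of r]
    proof eventually_elim
      case (elim z)
      then show ?case
        using mult_left_mono[OF mixture_le[of "z / r" k], of c] assms
        by (simp add: C_def real_sqrt_divide mult.assoc)
    qed
    with not_log_convex_on_subexponential[OF lim \<open>0 < C\<close> _ this] L' assms show False by simp
  qed
qed

end

subsection \<open>The density of a product\<close>

text \<open>The map \<open>g s = \<sigma> * (sqrt (w + s\<^sup>2) + s)\<close> is an increasing
  bijection from the real line onto the positive half-line, with derivative
  \<open>g s / sqrt (w + s\<^sup>2)\<close>. Substitution is applied on compact intervals, and
  monotone convergence exhausts the line.\<close>

lemma nn_integral_positive_line_substitution:
  fixes h :: "real \<Rightarrow> ennreal"
  assumes [measurable]: "h \<in> borel_measurable borel"
    and w: "0 < w" and \<sigma>: "0 < \<sigma>"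
  shows "(\<integral>\<^sup>+x. h x * indicator {0<..} x \<partial>lborel) =
    (\<integral>\<^sup>+s. h (\<sigma> * (sqrt (w + s\<^sup>2) + s)) * ennreal (\<sigma> * (sqrt (w + s\<^sup>2) + s) / sqrt (w + s\<^sup>2)) \<partial>lborel)"
proof -
  define g where "g s = \<sigma> * (sqrt (w + s\<^sup>2) + s)" for s
  define g' where "g' s = \<sigma> * (sqrt (w + s\<^sup>2) + s) / sqrt (w + s\<^sup>2)" for s
  have q: "0 < w + s\<^sup>2" for s :: real using w by (simp add: add_pos_nonneg)
  have sq: "\<bar>s\<bar> < sqrt (w + s\<^sup>2)" for s :: real
    using w by (intro real_less_rsqrt) simp
  have gpos: "0 < g s" for s
    using sq[of s] \<sigma> by (simp add: g_def)
  have "((\<lambda>s. w + s\<^sup>2) has_real_derivative 2 * s) (at s)" for s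
    by (auto intro!: derivative_eq_intros)
  from DERIV_chain2[OF DERIV_real_sqrt[OF q] this]
  have deriv: "(g has_real_derivative g' s) (at s)" for s
    unfolding g_def g'_def
    by (rule DERIV_cong[OF DERIV_cmult[OF DERIV_add[OF _ DERIV_ident]]])
      (use q[of s] in \<open>simp add: field_simps\<close>)
  have g'0: "0 < g' s" for s using gpos[of s] q[of s] by (simp add: g'_def g_def)
  have contg': "continuous_on A g'" for A
    unfolding g'_def using q by (intro continuous_intros) (auto simp: less_imp_neq[symmetric])
  have mono: "g s \<le> g t" if "s \<le> t" for s t
    by (rule deriv_nonneg_imp_mono[OF deriv]) (use that g'0 in \<open>auto intro: less_imp_le\<close>)
  have [measurable]: "g \<in> borel_measurable borel" "g' \<in> borel_measurable borel"
    unfolding g_def g'_def by simp_all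
  \<comment> \<open>If \<open>y = S + s\<close> with \<open>S = sqrt (w + s\<^sup>2)\<close>, then
    \<open>w / y = S - s\<close>. Hence \<open>s = (y - w / y) / 2\<close> is the preimage.\<close>
  have surj: "\<exists>s. g s = x" if "0 < x" for x
  proof
    define y where "y = x / \<sigma>"
    have y: "0 < y" using that \<sigma> by (simp add: y_def)
    have "w + ((y - w / y) / 2)\<^sup>2 = ((y + w / y) / 2)\<^sup>2"
      using y by (simp add: field_simps power2_eq_square)
    then have "sqrt (w + ((y - w / y) / 2)\<^sup>2) = (y + w / y) / 2"
      using y w by simp
    then have "g ((y - w / y) / 2) = \<sigma> * ((y + w / y) / 2 + (y - w / y) / 2)"
      by (simp only: g_def)
    also have "\<dots> = \<sigma> * y" by (simp add: add_divide_distrib[symmetric])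
    finally show "g ((y - w / y) / 2) = x" using \<sigma> by (simp add: y_def)
  qed
  have sub: "(\<integral>\<^sup>+x. h x * indicator {g (- real n)..g (real n)} x \<partial>lborel)
      = (\<integral>\<^sup>+s. h (g s) * g' s * indicator {- real n..real n} s \<partial>lborel)" if "0 < n" for n :: nat
    by (rule nn_integral_substitution_aux[OF _ _ deriv contg']) (use that g'0 in \<open>auto intro: less_imp_le\<close>)
  have inc: "incseq (\<lambda>n x. F x * indicator (I n) x :: ennreal)"
    if "\<And>m n. m \<le> n \<Longrightarrow> I m \<subseteq> I n" for F :: "real \<Rightarrow> ennreal" and I :: "nat \<Rightarrow> real set"
    using that by (fastforce simp: incseq_def le_fun_def indicator_def)
  have sup: "(SUP n. F x * indicator (I n) x) = F x * indicator (\<Union>n. I n) x"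
    if "\<And>m n. m \<le> n \<Longrightarrow> I m \<subseteq> I n" for F :: "real \<Rightarrow> ennreal" and I :: "nat \<Rightarrow> real set" and x
  proof (cases "x \<in> (\<Union>n. I n)")
    case True
    then obtain n where n: "x \<in> I n" by auto
    show ?thesis
    proof (rule antisym)
      show "(SUP n. F x * indicator (I n) x) \<le> F x * indicator (\<Union>n. I n) x"
        by (rule SUP_least) (auto simp: indicator_def)
      show "F x * indicator (\<Union>n. I n) x \<le> (SUP n. F x * indicator (I n) x)"
        by (rule SUP_upper2[of n]) (use n True in auto)
    qed
  qed (auto simp: indicator_def)
  \<comment> \<open>The successor keeps the intervals nondegenerate, as \<open>sub\<close> demands
    \<open>0 < n\<close>.\<close>
  define I where "I n = {g (- real (Suc n))..g (real (Suc n))}" for n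
  define J where "J n = {- real (Suc n)..real (Suc n)}" for n
  have Im: "m \<le> n \<Longrightarrow> I m \<subseteq> I n" for m n
    unfolding I_def by (auto intro: order_trans[OF mono] order_trans[OF _ mono])
  have Jm: "m \<le> n \<Longrightarrow> J m \<subseteq> J n" for m n by (auto simp: J_def)
  have UJ: "(\<Union>n. J n) = UNIV"
  proof -
    have "\<exists>n. s \<in> J n" for s
    proof -
      obtain n where "\<bar>s\<bar> \<le> real n" using real_arch_simple by blast
      then have "s \<in> J n" by (auto simp: J_def)
      then show ?thesis ..
    qed
    then show ?thesis by auto
  qed
  have UI: "(\<Union>n. I n) = {0<..}"
  proof (intro equalityI subsetI)
    fix x assume "x \<in> (\<Union>n. I n)"
    then show "x \<in> {0<..}" using gpos by (auto simp: I_def intro: less_le_trans)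
  next
    fix x :: real assume "x \<in> {0<..}"
    then obtain s where s: "g s = x" using surj by auto
    then obtain n where "s \<in> J n" using UJ by blast
    then have "x \<in> I n" using mono s by (auto simp: I_def J_def)
    then show "x \<in> (\<Union>n. I n)" by auto
  qed
  have [measurable]: "I n \<in> sets borel" "J n \<in> sets borel" for n by (auto simp: I_def J_def)
  have "(\<integral>\<^sup>+x. h x * indicator {0<..} x \<partial>lborel) = (\<integral>\<^sup>+x. (SUP n. h x * indicator (I n) x) \<partial>lborel)"
    by (simp only: sup[OF Im, where F = h] UI)
  also have "\<dots> = (SUP n. \<integral>\<^sup>+x. h x * indicator (I n) x \<partial>lborel)"
    by (rule nn_integral_monotone_convergence_SUP[OF inc[OF Im]]) measurable
  also have "\<dots> = (SUP n. \<integral>\<^sup>+s. h (g s) * g' s * indicator (J n) s \<partial>lborel)"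
    unfolding I_def J_def by (subst sub) simp_all
  also have "\<dots> = (\<integral>\<^sup>+s. (SUP n. h (g s) * g' s * indicator (J n) s) \<partial>lborel)"
    by (rule nn_integral_monotone_convergence_SUP[OF inc[OF Jm], symmetric]) measurable
  also have "\<dots> = (\<integral>\<^sup>+s. h (g s) * g' s \<partial>lborel)"
    by (simp add: sup[OF Jm, where F = \<open>\<lambda>s. h (g s) * g' s\<close>] UJ)
  finally show ?thesis by (simp add: g_def g'_def)
qed

lemma nn_integral_lborel_reflect:
  fixes h :: "real \<Rightarrow> ennreal"
  assumes [measurable]: "h \<in> borel_measurable borel"
  shows "(\<integral>\<^sup>+x. h (- x) \<partial>lborel) = (\<integral>\<^sup>+x. h x \<partial>lborel)"
  using nn_integral_real_affine[OF assms, of "-1" 0] by simp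

lemma nn_integral_real_line_split:
  fixes h :: "real \<Rightarrow> ennreal"
  assumes [measurable]: "h \<in> borel_measurable borel"
  shows "(\<integral>\<^sup>+x. h x \<partial>lborel) =
    (\<integral>\<^sup>+x. h x * indicator {0<..} x \<partial>lborel) + (\<integral>\<^sup>+x. h (- x) * indicator {0<..} x \<partial>lborel)"
proof -
  have "(\<integral>\<^sup>+x. h x \<partial>lborel) = (\<integral>\<^sup>+x. h x * indicator {0<..} x + h x * indicator {..<0} x \<partial>lborel)"
    by (rule nn_integral_cong_AE, rule eventually_mono[OF AE_lborel_singleton[of 0]])
      (auto simp: indicator_def)
  also have "\<dots> = (\<integral>\<^sup>+x. h x * indicator {0<..} x \<partial>lborel) + (\<integral>\<^sup>+x. h x * indicator {..<0} x \<partial>lborel)"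
    by (rule nn_integral_add) measurable
  also have "(\<integral>\<^sup>+x. h x * indicator {..<0} x \<partial>lborel) = (\<integral>\<^sup>+x. h (- x) * indicator {..<0} (- x) \<partial>lborel)"
    by (rule nn_integral_lborel_reflect[symmetric]) measurable
  finally show ?thesis by (simp add: indicator_def)
qed

text \<open>Both sides have the same integral over every Borel set \<open>A\<close>: for fixed
  nonzero \<open>x\<close> the substitution \<open>y = z / x\<close> has Jacobian
  \<open>1 / \<bar>x\<bar>\<close>, and Fubini exchanges \<open>x\<close> and \<open>z\<close>.
  Densities with respect to a sigma-finite measure are unique up to null sets.\<close>

lemma distributed_mult_density:
  fixes f :: "real \<times> real \<Rightarrow> ennreal" and p :: "real \<Rightarrow> ennreal"
  assumes XY: "distributed M (lborel \<Otimes>\<^sub>M lborel) (\<lambda>\<omega>. (X \<omega>, Y \<omega>)) f"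
    and Z: "distributed M lborel (\<lambda>\<omega>. X \<omega> * Y \<omega>) p"
  shows "AE z in lborel. p z = (\<integral>\<^sup>+x. f (x, z / x) * ennreal (1 / \<bar>x\<bar>) \<partial>lborel)"
proof (rule sigma_finite_measure.density_unique2[OF sigma_finite_lborel])
  have f [measurable]: "f \<in> borel_measurable (borel \<Otimes>\<^sub>M borel)"
    using distributed_borel_measurable[OF XY] by (simp cong: measurable_cong_sets add: sets_pair_measure_cong[OF sets_lborel sets_lborel])
  show "p \<in> borel_measurable lborel" by (rule distributed_borel_measurable[OF Z])
  show "(\<lambda>z. \<integral>\<^sup>+x. f (x, z / x) * ennreal (1 / \<bar>x\<bar>) \<partial>lborel) \<in> borel_measurable lborel"
    by measurable
  fix A :: "real set" assume "A \<in> sets lborel"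
  then have [measurable]: "A \<in> sets borel" by simp
  have inner: "(\<integral>\<^sup>+y. f (x, y) * indicator A (x * y) \<partial>lborel)
      = (\<integral>\<^sup>+z. f (x, z / x) * ennreal (1 / \<bar>x\<bar>) * indicator A z \<partial>lborel)" if x: "x \<noteq> 0" for x
  proof -
    have "(\<integral>\<^sup>+y. f (x, y) * indicator A (x * y) \<partial>lborel)
        = ennreal \<bar>1 / x\<bar> * (\<integral>\<^sup>+z. f (x, 0 + 1 / x * z) * indicator A (x * (0 + 1 / x * z)) \<partial>lborel)"
      by (rule nn_integral_real_affine) (use x in auto)
    also have "\<dots> = (\<integral>\<^sup>+z. ennreal \<bar>1 / x\<bar> * (f (x, z / x) * indicator A z) \<partial>lborel)"
      using x by (subst nn_integral_cmult[symmetric]) auto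
    finally show ?thesis by (simp add: mult_ac)
  qed
  have "(\<integral>\<^sup>+z\<in>A. p z \<partial>lborel) = (\<integral>\<^sup>+\<omega>. indicator A (X \<omega> * Y \<omega>) \<partial>M)"
    by (rule distributed_nn_integral[OF Z]) measurable
  also have "\<dots> = (\<integral>\<^sup>+\<omega>. (\<lambda>(x, y). indicator A (x * y)) (X \<omega>, Y \<omega>) \<partial>M)" by simp
  also have "\<dots> = (\<integral>\<^sup>+xy. f xy * (\<lambda>(x, y). indicator A (x * y)) xy \<partial>(lborel \<Otimes>\<^sub>M lborel))"
    by (rule distributed_nn_integral[OF XY, symmetric]) measurable
  also have "\<dots> = (\<integral>\<^sup>+x. \<integral>\<^sup>+y. f (x, y) * indicator A (x * y) \<partial>lborel \<partial>lborel)"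
    by (subst lborel.nn_integral_fst[symmetric]) simp_all
  also have "\<dots> = (\<integral>\<^sup>+x. \<integral>\<^sup>+z. f (x, z / x) * ennreal (1 / \<bar>x\<bar>) * indicator A z \<partial>lborel \<partial>lborel)"
    by (rule nn_integral_cong_AE, rule eventually_mono[OF AE_lborel_singleton[of 0]]) (rule inner)
  also have "\<dots> = (\<integral>\<^sup>+z. \<integral>\<^sup>+x. f (x, z / x) * ennreal (1 / \<bar>x\<bar>) * indicator A z \<partial>lborel \<partial>lborel)"
    by (rule lborel_pair.Fubini') measurable
  also have "\<dots> = (\<integral>\<^sup>+z\<in>A. (\<integral>\<^sup>+x. f (x, z / x) * ennreal (1 / \<bar>x\<bar>) \<partial>lborel) \<partial>lborel)"
    by (subst nn_integral_multc) simp_all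
  finally show "(\<integral>\<^sup>+z\<in>A. p z \<partial>lborel) = (\<integral>\<^sup>+z\<in>A. (\<integral>\<^sup>+x. f (x, z / x) * ennreal (1 / \<bar>x\<bar>) \<partial>lborel) \<partial>lborel)" .
qed

text \<open>The points of \<open>S\<close> where \<open>f\<close> and \<open>g\<close> differ form
  an open null set, which must be empty.\<close>

lemma continuous_AE_eq_imp_eq:
  fixes f g :: "real \<Rightarrow> real"
  assumes "open S" "continuous_on S f" "continuous_on S g"
    and "AE x in lborel. x \<in> S \<longrightarrow> f x = g x" and "x \<in> S"
  shows "f x = g x"
proof (rule ccontr)
  assume ne: "f x \<noteq> g x"
  let ?D = "{x \<in> S. f x - g x \<noteq> 0}"
  have "open ?D"
    using continuous_open_preimage[OF continuous_on_diff[OF assms(2,3)] assms(1), of "- {0}"]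
    by (simp add: vimage_def Int_def open_Compl)
  moreover have "x \<in> ?D" using ne assms(5) by simp
  ultimately have "\<not> negligible ?D" using open_not_negligible by blast
  moreover have "AE x in lborel. x \<notin> ?D"
    using assms(4) by eventually_elim auto
  then have "?D \<in> null_sets lborel"
    using \<open>open ?D\<close> by (subst (asm) AE_iff_null_sets[symmetric]) auto
  then have "negligible ?D" by (simp add: negligible_iff_null_sets null_sets_completionI)
  ultimately show False by simp
qed


subsection \<open>The bivariate normal case\<close>

text \<open>The part of the rotated Gaussian exponent that does not depend on \<open>z\<close>. The
  term \<open>s\<^sup>2 / (1 + \<rho>)\<close> stems from expanding the square in \<open>S\<close>
  and replacing \<open>S\<^sup>2\<close> by \<open>w + s\<^sup>2\<close>; \<open>n\<close> is half
  the difference of the standardised means. No normalising constant is included.\<close>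

definition normal_product_weight :: "real \<Rightarrow> real \<Rightarrow> real \<Rightarrow> real" where
  "normal_product_weight \<rho> n s = exp (- ((s - n)\<^sup>2 / (1 - \<rho>) + s\<^sup>2 / (1 + \<rho>)))"

text \<open>The factor \<open>exp (- s\<^sup>2 / (1 + \<rho>))\<close> absorbs
  \<open>exp (K * \<bar>s\<bar>)\<close> up to a constant; what remains is a multiple of the normal
  density with mean \<open>n\<close> and variance \<open>(1 - \<rho>) / 2\<close>.\<close>

lemma exp_integrable_normal_product_weight:
  assumes "- 1 < \<rho>" "\<rho> < 1"
  shows "exp_integrable_weight (normal_product_weight \<rho> n)"
proof
  show [measurable]: "normal_product_weight \<rho> n \<in> borel_measurable borel"
    unfolding normal_product_weight_def by simp
  show "0 < normal_product_weight \<rho> n s" for s by (simp add: normal_product_weight_def)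
  fix K :: real
  define \<sigma> where "\<sigma> = sqrt ((1 - \<rho>) / 2)"
  have \<sigma>: "0 < \<sigma>" "2 * \<sigma>\<^sup>2 = 1 - \<rho>" using assms by (simp_all add: \<sigma>_def)
  define C where "C = exp (K\<^sup>2 * (1 + \<rho>) / 4) * sqrt (2 * pi * \<sigma>\<^sup>2)"
  have "normal_product_weight \<rho> n s * exp (K * \<bar>s\<bar>) \<le> C * normal_density n \<sigma> s" for s
  proof -
    define A where "A = 1 + \<rho>"
    have A: "0 < A" using assms by (simp add: A_def)
    \<comment> \<open>Completing the square: \<open>K * \<bar>s\<bar> - s\<^sup>2 / A\<close> is at
      most \<open>K\<^sup>2 * A / 4\<close>.\<close>
    then have "0 \<le> (\<bar>s\<bar> / A - K / 2)\<^sup>2 * A" by simp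
    also have "\<dots> = s\<^sup>2 / A + K\<^sup>2 * A / 4 - K * \<bar>s\<bar>"
      using A by (simp add: power2_diff power_divide field_simps power2_eq_square)
    finally have "normal_product_weight \<rho> n s * exp (K * \<bar>s\<bar>)
        \<le> exp (K\<^sup>2 * (1 + \<rho>) / 4) * exp (- (s - n)\<^sup>2 / (1 - \<rho>))"
      by (simp add: normal_product_weight_def exp_add[symmetric] A_def)
    also have "\<dots> = C * normal_density n \<sigma> s"
      using \<sigma> by (simp add: C_def normal_density_def)
    finally show ?thesis .
  qed
  then show "integrable lborel (\<lambda>s. normal_product_weight \<rho> n s * exp (K * \<bar>s\<bar>))"
    using \<sigma> by (intro Bochner_Integration.integrable_bound[OF integrable_mult_right[OF integrable_normal_density[of \<sigma> n], of C]])
      (auto simp: normal_product_weight_def intro!: AE_I2 order_trans[OF _ abs_ge_self])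
qed

text \<open>The rotation by 45 degrees diagonalises the covariance of the standardised vector.\<close>

lemma bivariate_normal_density_rotated:
  assumes "0 < \<sigma>X" "0 < \<sigma>Y" "- 1 < \<rho>" "\<rho> < 1"
  shows "bivariate_normal_density \<mu>X \<mu>Y \<sigma>X \<sigma>Y \<rho> (\<sigma>X * (S + s), \<sigma>Y * (S - s)) =
    1 / (2 * pi * \<sigma>X * \<sigma>Y * sqrt (1 - \<rho>\<^sup>2)) *
    exp (- ((S - (\<mu>X / \<sigma>X + \<mu>Y / \<sigma>Y) / 2)\<^sup>2 / (1 + \<rho>) + (s - (\<mu>X / \<sigma>X - \<mu>Y / \<sigma>Y) / 2)\<^sup>2 / (1 - \<rho>)))"
proof -
  define a b where "a = \<mu>X / \<sigma>X" and "b = \<mu>Y / \<sigma>Y"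
  have u: "(\<sigma>X * (S + s) - \<mu>X) / \<sigma>X = S + s - a" and v: "(\<sigma>Y * (S - s) - \<mu>Y) / \<sigma>Y = S - s - b"
    using assms by (simp_all add: a_def b_def field_simps)
  have \<rho>: "1 - \<rho>\<^sup>2 = (1 - \<rho>) * (1 + \<rho>)" by (simp add: power2_eq_square algebra_simps)
  define A B where "A = 1 + \<rho>" and "B = 1 - \<rho>"
  have AB: "A \<noteq> 0" "B \<noteq> 0" using assms by (auto simp: A_def B_def)
  define x y where "x = S - (a + b) / 2" and "y = s - (a - b) / 2"
  have "(S + s - a)\<^sup>2 - 2 * \<rho> * (S + s - a) * (S - s - b) + (S - s - b)\<^sup>2 = 2 * (B * x\<^sup>2 + A * y\<^sup>2)"
    unfolding A_def B_def x_def y_def by (simp add: power2_eq_square field_simps)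
  also have "2 * (B * x\<^sup>2 + A * y\<^sup>2) / (2 * (B * A)) = x\<^sup>2 / A + y\<^sup>2 / B"
    using AB by (simp add: field_simps)
  finally have "- ((S + s - a)\<^sup>2 - 2 * \<rho> * (S + s - a) * (S - s - b) + (S - s - b)\<^sup>2) / (2 * (1 - \<rho>\<^sup>2))
      = - (x\<^sup>2 / A + y\<^sup>2 / B)"
    by (simp only: \<rho> A_def B_def minus_divide_left[symmetric])
  then show ?thesis
    unfolding bivariate_normal_density_def prod.case u v
    by (simp only: x_def y_def A_def B_def a_def b_def)
qed

text \<open>The integral is split by the sign of \<open>x\<close> and each half is parametrised by
  \<open>s\<close>. In the rotated coordinates the branches differ only in the sign of
  \<open>S\<close>, so their sum produces the \<open>cosh\<close> of the mixture.\<close>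

lemma nn_integral_bivariate_normal_density_hyperbola:
  fixes \<mu>X \<mu>Y \<sigma>X \<sigma>Y \<rho> z :: real
  assumes \<sigma>: "0 < \<sigma>X" "0 < \<sigma>Y" and \<rho>: "- 1 < \<rho>" "\<rho> < 1" and z: "0 < z"
  defines "m \<equiv> (\<mu>X / \<sigma>X + \<mu>Y / \<sigma>Y) / 2" and "n \<equiv> (\<mu>X / \<sigma>X - \<mu>Y / \<sigma>Y) / 2"
  shows "(\<integral>\<^sup>+x. ennreal (bivariate_normal_density \<mu>X \<mu>Y \<sigma>X \<sigma>Y \<rho> (x, z / x)) * ennreal (1 / \<bar>x\<bar>) \<partial>lborel) =
    ennreal (exp (- (m\<^sup>2 / (1 + \<rho>))) / (pi * \<sigma>X * \<sigma>Y * sqrt (1 - \<rho>\<^sup>2)) *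
      exp (- 1 / (\<sigma>X * \<sigma>Y * (1 + \<rho>)) * z) *
      exp_integrable_weight.mixture (normal_product_weight \<rho> n) (2 * m / (1 + \<rho>)) (z / (\<sigma>X * \<sigma>Y)))"
proof -
  interpret exp_integrable_weight "normal_product_weight \<rho> n"
    by (rule exp_integrable_normal_product_weight[OF \<rho>])
  let ?f = "bivariate_normal_density \<mu>X \<mu>Y \<sigma>X \<sigma>Y \<rho>"
  let ?k = "2 * m / (1 + \<rho>)"
  have [measurable]: "?f \<in> borel_measurable (borel \<Otimes>\<^sub>M borel)"
    unfolding bivariate_normal_density_def by measurable
  define w where "w = z / (\<sigma>X * \<sigma>Y)"
  have w: "0 < w" "z = \<sigma>X * \<sigma>Y * w" using z \<sigma> by (simp_all add: w_def)
  define S where "S s = sqrt (w + s\<^sup>2)" for s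
  have S2: "(S s)\<^sup>2 = w + s\<^sup>2" and S0: "0 < S s" for s
    using w by (simp_all add: S_def add_pos_nonneg)
  have S_gt: "0 < S s + s" for s
    using real_less_rsqrt[of "\<bar>s\<bar>" "w + s\<^sup>2"] w by (simp add: S_def)
  have [measurable]: "S \<in> borel_measurable borel" unfolding S_def by simp
  have S_even: "S (- s) = S s" for s by (simp add: S_def)
  define c where "c = 1 / (2 * pi * \<sigma>X * \<sigma>Y * sqrt (1 - \<rho>\<^sup>2))"
  have c: "0 < c" using \<sigma> \<rho> by (simp add: c_def abs_square_less_1)
  have f0: "0 \<le> ?f x" for x
    using c by (simp add: bivariate_normal_density_def c_def split: prod.split)
  \<comment> \<open>The sign \<open>e\<close> selects the branch of the hyperbola. The Jacobian
    \<open>\<sigma>X * (S s + s) / S s\<close> cancels \<open>1 / \<bar>x\<bar>\<close> up to the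
    factor \<open>1 / S s\<close>.\<close>
  have branch: "(\<integral>\<^sup>+x. ennreal (?f (e * x, z / (e * x)) / \<bar>x\<bar>) * indicator {0<..} x \<partial>lborel)
      = (\<integral>\<^sup>+s. ennreal (?f (e * (\<sigma>X * (S s + s)), e * (\<sigma>Y * (S s - s))) / S s) \<partial>lborel)"
    if e: "e = 1 \<or> e = - 1" for e
  proof -
    have "(\<integral>\<^sup>+x. ennreal (?f (e * x, z / (e * x)) / \<bar>x\<bar>) * indicator {0<..} x \<partial>lborel)
      = (\<integral>\<^sup>+s. ennreal (?f (e * (\<sigma>X * (S s + s)), z / (e * (\<sigma>X * (S s + s)))) / \<bar>\<sigma>X * (S s + s)\<bar>)
          * ennreal (\<sigma>X * (S s + s) / S s) \<partial>lborel)"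
      unfolding S_def by (rule nn_integral_positive_line_substitution[OF _ w(1) \<sigma>(1)]) measurable
    also have "\<dots> = (\<integral>\<^sup>+s. ennreal (?f (e * (\<sigma>X * (S s + s)), e * (\<sigma>Y * (S s - s))) / S s) \<partial>lborel)"
    proof (rule nn_integral_cong)
      fix s
      have "w = (S s + s) * (S s - s)"
        using S2[of s] by (simp add: power2_eq_square algebra_simps)
      then have "z = (\<sigma>X * (S s + s)) * (\<sigma>Y * (S s - s))"
        using w(2) by simp
      moreover have "\<sigma>X * (S s + s) \<noteq> 0" using \<sigma> S_gt[of s] by simp
      ultimately have "z / (e * (\<sigma>X * (S s + s))) = e * (\<sigma>Y * (S s - s))"
        using e by (elim disjE) (simp_all only: not_False_eq_True nonzero_mult_div_cancel_left mult_1 mult_minus1 divide_minus_right)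
      then show "ennreal (?f (e * (\<sigma>X * (S s + s)), z / (e * (\<sigma>X * (S s + s)))) / \<bar>\<sigma>X * (S s + s)\<bar>)
          * ennreal (\<sigma>X * (S s + s) / S s)
        = ennreal (?f (e * (\<sigma>X * (S s + s)), e * (\<sigma>Y * (S s - s))) / S s)"
        using S_gt[of s] S0[of s] \<sigma> f0 by (simp add: ennreal_mult[symmetric] abs_of_pos)
    qed
    finally show ?thesis .
  qed
  have weight: "?f (\<sigma>X * (S s + s), \<sigma>Y * (S s - s)) + ?f (- (\<sigma>X * (S s - s)), - (\<sigma>Y * (S s + s)))
      = 2 * c * exp (- (m\<^sup>2 / (1 + \<rho>))) * exp (- (w / (1 + \<rho>))) *
        (normal_product_weight \<rho> n s * cosh (?k * S s))" for s
  proof -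
    \<comment> \<open>Expanding the square with \<open>S\<^sup>2 = w + s\<^sup>2\<close> distributes
      the terms: \<open>w\<close> gives the exponential in \<open>z\<close>,
      \<open>s\<^sup>2\<close> joins the weight, and the cross term gives
      \<open>exp (e * (?k * S s))\<close>.\<close>
    have sq: "exp (- ((e * S s - m)\<^sup>2 / (1 + \<rho>) + (s - n)\<^sup>2 / (1 - \<rho>)))
        = exp (- (m\<^sup>2 / (1 + \<rho>))) * exp (- (w / (1 + \<rho>))) * normal_product_weight \<rho> n s * exp (e * (?k * S s))"
      if "e = 1 \<or> e = -1" for e
    proof -
      have "(e * S s - m)\<^sup>2 = w + s\<^sup>2 + m\<^sup>2 - e * (2 * m * S s)"
        using that S2[of s] by (auto simp: power2_eq_square algebra_simps)
      then have "(e * S s - m)\<^sup>2 / (1 + \<rho>) = w / (1 + \<rho>) + s\<^sup>2 / (1 + \<rho>) + m\<^sup>2 / (1 + \<rho>) - e * (?k * S s)"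
        by (simp add: add_divide_distrib diff_divide_distrib)
      then show ?thesis by (simp add: normal_product_weight_def exp_add[symmetric])
    qed
    have "?f (\<sigma>X * (S s + s), \<sigma>Y * (S s - s)) = c * exp (- ((1 * S s - m)\<^sup>2 / (1 + \<rho>) + (s - n)\<^sup>2 / (1 - \<rho>)))"
      using bivariate_normal_density_rotated[OF \<sigma> \<rho>, of \<mu>X \<mu>Y "S s" s] by (simp add: c_def m_def n_def)
    \<comment> \<open>The negative branch is the rotated form with \<open>- S s\<close> in place of
      \<open>S s\<close> and the same \<open>s\<close>.\<close>
    moreover have "(- (\<sigma>X * (S s - s)), - (\<sigma>Y * (S s + s))) = (\<sigma>X * (- S s + s), \<sigma>Y * (- S s - s))"
      by (simp add: algebra_simps)
    then have "?f (- (\<sigma>X * (S s - s)), - (\<sigma>Y * (S s + s)))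
        = c * exp (- ((- 1 * S s - m)\<^sup>2 / (1 + \<rho>) + (s - n)\<^sup>2 / (1 - \<rho>)))"
      using bivariate_normal_density_rotated[OF \<sigma> \<rho>, of \<mu>X \<mu>Y "- S s" s]
      by (simp add: c_def m_def n_def)
    ultimately show ?thesis
      by (simp only: sq simp_thms) (simp add: cosh_def algebra_simps)
  qed
  have "(\<integral>\<^sup>+x. ennreal (?f (x, z / x)) * ennreal (1 / \<bar>x\<bar>) \<partial>lborel)
      = (\<integral>\<^sup>+x. ennreal (?f (x, z / x) / \<bar>x\<bar>) \<partial>lborel)"
    using f0 by (simp add: ennreal_mult[symmetric])
  also have "\<dots> = (\<integral>\<^sup>+x. ennreal (?f (1 * x, z / (1 * x)) / \<bar>x\<bar>) * indicator {0<..} x \<partial>lborel)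
      + (\<integral>\<^sup>+x. ennreal (?f (- 1 * x, z / (- 1 * x)) / \<bar>x\<bar>) * indicator {0<..} x \<partial>lborel)"
    by (subst nn_integral_real_line_split) simp_all
  also have "\<dots> = (\<integral>\<^sup>+s. ennreal (?f (1 * (\<sigma>X * (S s + s)), 1 * (\<sigma>Y * (S s - s))) / S s) \<partial>lborel)
      + (\<integral>\<^sup>+s. ennreal (?f (- 1 * (\<sigma>X * (S s + s)), - 1 * (\<sigma>Y * (S s - s))) / S s) \<partial>lborel)"
    by (subst (1 2) branch) simp_all
  \<comment> \<open>Replacing \<open>s\<close> by \<open>- s\<close> on the negative branch aligns
    its Gaussian factor in \<open>s\<close> with that of the positive branch.\<close>
  also have "(\<integral>\<^sup>+s. ennreal (?f (- 1 * (\<sigma>X * (S s + s)), - 1 * (\<sigma>Y * (S s - s))) / S s) \<partial>lborel)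
      = (\<integral>\<^sup>+s. ennreal (?f (- (\<sigma>X * (S s - s)), - (\<sigma>Y * (S s + s))) / S s) \<partial>lborel)"
    by (subst nn_integral_lborel_reflect[symmetric]) (simp_all add: S_even)
  also have "(\<integral>\<^sup>+s. ennreal (?f (1 * (\<sigma>X * (S s + s)), 1 * (\<sigma>Y * (S s - s))) / S s) \<partial>lborel) + \<dots>
      = (\<integral>\<^sup>+s. ennreal (?f (\<sigma>X * (S s + s), \<sigma>Y * (S s - s)) / S s)
          + ennreal (?f (- (\<sigma>X * (S s - s)), - (\<sigma>Y * (S s + s))) / S s) \<partial>lborel)"
    by (subst nn_integral_add) simp_all
  also have "\<dots> = (\<integral>\<^sup>+s. ennreal (2 * c * exp (- (m\<^sup>2 / (1 + \<rho>))) * exp (- (w / (1 + \<rho>))) *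
      (normal_product_weight \<rho> n s * (cosh (?k * S s) / S s))) \<partial>lborel)"
    using f0 S0 weight
    by (simp add: ennreal_plus[symmetric] add_divide_distrib[symmetric] less_imp_le del: ennreal_plus)
  also have "\<dots> = ennreal (LBINT s. 2 * c * exp (- (m\<^sup>2 / (1 + \<rho>))) * exp (- (w / (1 + \<rho>))) *
      (normal_product_weight \<rho> n s * (cosh (?k * S s) / S s)))"
    using weight_pos c S0 w unfolding S_def
    by (intro nn_integral_eq_integral integrable_mult_right integrable_kernel) (auto simp: less_imp_le)
  also have "\<dots> = ennreal (2 * c * exp (- (m\<^sup>2 / (1 + \<rho>))) * exp (- (w / (1 + \<rho>))) * mixture ?k w)"
    by (simp only: mixture_def S_def integral_mult_right_zero)
  also have "2 * c * exp (- (m\<^sup>2 / (1 + \<rho>))) = exp (- (m\<^sup>2 / (1 + \<rho>))) / (pi * \<sigma>X * \<sigma>Y * sqrt (1 - \<rho>\<^sup>2))"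
    by (simp add: c_def)
  also have "- (w / (1 + \<rho>)) = - 1 / (\<sigma>X * \<sigma>Y * (1 + \<rho>)) * z"
    by (simp add: w_def)
  finally show ?thesis by (simp add: w_def)
qed

text \<open>By continuity the almost everywhere identity becomes \<open>q = \<phi>\<close> on the
  whole half-line, and the mixture criterion applies to \<open>\<phi>\<close>. A general
  \<open>q\<close> is allowed so that the result covers both \<open>p z\<close> and
  \<open>p (- z)\<close>.\<close>

lemma log_convex_on_hyperbola_density_iff:
  fixes q :: "real \<Rightarrow> real"
  assumes \<sigma>: "0 < \<sigma>X" "0 < \<sigma>Y" and \<rho>: "- 1 < \<rho>" "\<rho> < 1"
    and q: "\<And>z. 0 \<le> q z" "continuous_on {0<..} q"
    and AE: "AE z in lborel. 0 < z \<longrightarrow> ennreal (q z) =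
      (\<integral>\<^sup>+x. ennreal (bivariate_normal_density \<mu>X \<mu>Y \<sigma>X \<sigma>Y \<rho> (x, z / x)) * ennreal (1 / \<bar>x\<bar>) \<partial>lborel)"
  shows "log_convex_on {0<..} q \<longleftrightarrow> \<mu>X / \<sigma>X + \<mu>Y / \<sigma>Y = 0"
proof -
  define m n where "m = (\<mu>X / \<sigma>X + \<mu>Y / \<sigma>Y) / 2" and "n = (\<mu>X / \<sigma>X - \<mu>Y / \<sigma>Y) / 2"
  interpret exp_integrable_weight "normal_product_weight \<rho> n"
    by (rule exp_integrable_normal_product_weight[OF \<rho>])
  define C where "C = exp (- (m\<^sup>2 / (1 + \<rho>))) / (pi * \<sigma>X * \<sigma>Y * sqrt (1 - \<rho>\<^sup>2))"
  have C: "0 < C" using \<sigma> \<rho> by (simp add: C_def abs_square_less_1)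
  define b where "b = - 1 / (\<sigma>X * \<sigma>Y * (1 + \<rho>))"
  define \<phi> where "\<phi> z = C * exp (b * z) * mixture (2 * m / (1 + \<rho>)) (z / (\<sigma>X * \<sigma>Y))" for z
  have mix0: "0 \<le> mixture k w" if "0 < w" for k w
    unfolding mixture_def using that weight_pos
    by (intro integral_nonneg_AE AE_I2 mult_nonneg_nonneg divide_nonneg_nonneg) (auto simp: less_imp_le)
  have "continuous_on {0<..} (\<lambda>z. mixture (2 * m / (1 + \<rho>)) (z / (\<sigma>X * \<sigma>Y)))"
    by (rule continuous_on_compose2[OF continuous_on_mixture]) (use \<sigma> in \<open>auto intro!: continuous_intros\<close>)
  then have cont: "continuous_on {0<..} \<phi>"
    unfolding \<phi>_def by (intro continuous_intros)
  have "AE z in lborel. z \<in> {0<..} \<longrightarrow> q z = \<phi> z"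
    using AE
  proof eventually_elim
    case (elim z)
    show ?case
    proof
      assume "z \<in> {0<..}"
      then have z: "0 < z" by simp
      have "ennreal (q z) = ennreal (\<phi> z)"
        using elim z nn_integral_bivariate_normal_density_hyperbola[OF \<sigma> \<rho> z, of \<mu>X \<mu>Y]
        by (simp add: \<phi>_def C_def b_def m_def n_def)
      \<comment> \<open>Since \<open>ennreal\<close> sends all negative reals to 0, cancelling it
        relies on both values being nonnegative.\<close>
      then show "q z = \<phi> z"
        using q(1)[of z] mix0[of "z / (\<sigma>X * \<sigma>Y)"] z C \<sigma> by (simp add: \<phi>_def)
    qed
  qed
  then have "\<And>z. z \<in> {0<..} \<Longrightarrow> q z = \<phi> z"
    by (rule continuous_AE_eq_imp_eq[OF open_greaterThan q(2) cont])
  then have "log_convex_on {0<..} q \<longleftrightarrow> log_convex_on {0<..} \<phi>"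
    by (intro log_convex_on_cong convex_real_interval)
  also have "\<dots> \<longleftrightarrow> 2 * m / (1 + \<rho>) = 0"
    unfolding \<phi>_def using C \<sigma> by (intro log_convex_on_mixture_iff) auto
  also have "\<dots> \<longleftrightarrow> \<mu>X / \<sigma>X + \<mu>Y / \<sigma>Y = 0"
    using \<rho> by (auto simp: m_def)
  finally show ?thesis .
qed

section \<open>Reflection and the two half-lines\<close>

lemma bivariate_normal_density_reflect:
  assumes "\<sigma>Y \<noteq> 0"
  shows "bivariate_normal_density \<mu>X \<mu>Y \<sigma>X \<sigma>Y \<rho> (x, - y) = bivariate_normal_density \<mu>X (- \<mu>Y) \<sigma>X \<sigma>Y (- \<rho>) (x, y)"
proof -
  have "(- y - \<mu>Y) / \<sigma>Y = - ((y - - \<mu>Y) / \<sigma>Y)" using assms by (simp add: field_simps)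
  then show ?thesis by (simp only: bivariate_normal_density_def prod.case) simp
qed

text \<open>Log-convexity is a pointwise property, whereas \<open>distributed\<close> fixes a
  density only almost everywhere. Nonnegativity and continuity away from 0 single out the intended
  version on both half-lines.\<close>

theorem corollary2p6:
  fixes M :: "'a measure"
    and X Y :: "'a \<Rightarrow> real"
    and \<mu>X \<mu>Y \<sigma>X \<sigma>Y \<rho> :: real
    and p :: "real \<Rightarrow> real"
  assumes "prob_space M"
    and "0 < \<sigma>X" and "0 < \<sigma>Y" and "- 1 < \<rho>" and "\<rho> < 1"
    and "distributed M (lborel \<Otimes>\<^sub>M lborel) (\<lambda>\<omega>. (X \<omega>, Y \<omega>))
           (\<lambda>z. ennreal (bivariate_normal_density \<mu>X \<mu>Y \<sigma>X \<sigma>Y \<rho> z))"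
    and "distributed M lborel (\<lambda>\<omega>. X \<omega> * Y \<omega>) (\<lambda>z. ennreal (p z))"
    and "\<And>z. 0 \<le> p z"
    and "continuous_on (- {0}) p"
  shows "(log_convex_on {0<..} p \<longleftrightarrow> \<mu>X / \<sigma>X + \<mu>Y / \<sigma>Y = 0) \<and>
         (log_convex_on {..<0} p \<longleftrightarrow> \<mu>X / \<sigma>X - \<mu>Y / \<sigma>Y = 0) \<and>
         (log_convex_on {..<0} p \<and> log_convex_on {0<..} p \<longleftrightarrow> \<mu>X = 0 \<and> \<mu>Y = 0)"
proof -
  let ?q = "\<lambda>z. \<integral>\<^sup>+x. ennreal (bivariate_normal_density \<mu>X \<mu>Y \<sigma>X \<sigma>Y \<rho> (x, z / x)) * ennreal (1 / \<bar>x\<bar>) \<partial>lborel"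
  have AE: "AE z in lborel. ennreal (p z) = ?q z"
    by (rule distributed_mult_density[OF assms(6,7)])
  have pos: "log_convex_on {0<..} p \<longleftrightarrow> \<mu>X / \<sigma>X + \<mu>Y / \<sigma>Y = 0"
  proof (rule log_convex_on_hyperbola_density_iff[OF assms(2-5,8)])
    show "continuous_on {0<..} p" by (rule continuous_on_subset[OF assms(9)]) auto
    show "AE z in lborel. 0 < z \<longrightarrow> ennreal (p z) = ?q z" using AE by eventually_elim simp
  qed
  have "log_convex_on {..<0} p \<longleftrightarrow> log_convex_on {0<..} (\<lambda>z. p (- z))"
    by (rule log_convex_on_reflect)
  \<comment> \<open>The function \<open>p (- z)\<close> is a density of \<open>X * (- Y)\<close>,
    and the pair of \<open>X\<close> and \<open>- Y\<close> is bivariate normal with second mean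
    \<open>- \<mu>Y\<close> and correlation \<open>- \<rho>\<close>.\<close>
  also have "\<dots> \<longleftrightarrow> \<mu>X / \<sigma>X + - \<mu>Y / \<sigma>Y = 0"
  proof (rule log_convex_on_hyperbola_density_iff[OF assms(2,3) _ _ assms(8), of "- \<rho>"])
    show "continuous_on {0<..} (\<lambda>z. p (- z))"
      by (rule continuous_on_compose2[OF assms(9)]) (auto intro!: continuous_intros)
    \<comment> \<open>Invariance of Lebesgue measure under negation carries the almost everywhere
      identity from \<open>z\<close> to \<open>- z\<close>.\<close>
    have "AE z in distr lborel borel uminus. ennreal (p z) = ?q z"
      using AE unfolding lborel_distr_uminus .
    then have "AE z in lborel. ennreal (p (- z)) = ?q (- z)"
      by (rule AE_distrD[rotated]) simp
    then show "AE z in lborel. 0 < z \<longrightarrow> ennreal (p (- z)) =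
        (\<integral>\<^sup>+x. ennreal (bivariate_normal_density \<mu>X (- \<mu>Y) \<sigma>X \<sigma>Y (- \<rho>) (x, z / x)) * ennreal (1 / \<bar>x\<bar>) \<partial>lborel)"
      by eventually_elim (use assms(3) in \<open>simp add: bivariate_normal_density_reflect\<close>)
  qed (use assms in auto)
  finally have neg: "log_convex_on {..<0} p \<longleftrightarrow> \<mu>X / \<sigma>X - \<mu>Y / \<sigma>Y = 0" by simp
  have "\<mu>X / \<sigma>X - \<mu>Y / \<sigma>Y = 0 \<and> \<mu>X / \<sigma>X + \<mu>Y / \<sigma>Y = 0 \<longleftrightarrow> \<mu>X / \<sigma>X = 0 \<and> \<mu>Y / \<sigma>Y = 0"
    by linarith
  also have "\<dots> \<longleftrightarrow> \<mu>X = 0 \<and> \<mu>Y = 0" using assms(2,3) by simp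
  finally show ?thesis using pos neg by blast
qed

end
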